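(* Let $(X,\mathcal A,\mu)$ be a $\sigma$-finite complete measure space, $T:X\to X$ a non-singular measurable transformation with $\mu(T(A))\le\mu(A)$ for all $A\in\mathcal A$, and $u:X\to\mathbb C$ a measurable function which is bounded away from zero (there is $\epsilon>0$ with $|u(x)|>\epsilon$ a.e. on $X$), such that $W_{u,T}$ is a bounded operator on $L(p,q)$. If $\beta(W_{u,T})=\infty$, then for every $k\in\mathbb N\cup\{0\}$ the map $T_k=T|_{T^k(X)}:T^k(X)\to T^{k+1}(X)$ is not injective almost everywhere on $T^k(X)$.
   Context: For measurable $h:X\to\mathbb C$ put $\mu_h(s)=\mu(\{x\in X:|h(x)|>s\})$ for $s\ge 0$, $h^*(t)=\inf\{s>0:\mu_h(s)\le t\}$ and $h^{**}(t)=\frac1t\int_0^t h^*(s)\,ds$ for $t>0$. The Lorentz space $L(p,q)$ (for $1<p<\infty$, $1\le q<\infty$, or $1<p\le\infty$, $q=\infty$) is the Banach space of (a.e.-equivalence classes of) measurable $h:X\to\mathbb C$ with $\|h\|_{pq}<\infty$, where $\|h\|_{pq}=\left(\frac qp\int_0^\infty (t^{1/p}h^{**}(t))^q\frac{dt}{t}\right)^{1/q}$ if $1<p<\infty$, $1\le q<\infty$, and $\|h\|_{pq}=\sup_{t>0}t^{1/p}h^{**}(t)$ if $1<p\le\infty$, $q=\infty$. A measurable transformation $T:X\to X$ is non-singular if $\mu(A)=0$ implies $\mu(T^{-1}(A))=0$. The hypothesis $\mu(T(A))\le\mu(A)$ for $A\in\mathcal A$ includes that $T(A)\in\mathcal A$.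 $W_{u,T}f=(u\circ T)\cdot(f\circ T)$. The map $T_k$ is injective almost everywhere on $T^k(X)$ if the set $\{x\in T^k(X):\exists\,y\in T^k(X),\ y\neq x,\ T(x)=T(y)\}$ is measurable with $\mu$-measure zero. For a bounded operator $L$ with range $\mathcal R(L)$, the descent is $\beta(L)=\inf\{k\in\mathbb N\cup\{0\}:\mathcal R(L^{k+1})=\mathcal R(L^k)\}$ (equal to $\infty$ if no such $k$ exists). *)

theory Defs
  imports "HOL-Analysis.Analysis" "HOL-Library.Extended_Nat"
begin

section \<open>Lorentz spaces\<close>

definition distribution_fun :: "'a measure \<Rightarrow> ('a \<Rightarrow> complex) \<Rightarrow> real \<Rightarrow> ennreal" where
  "distribution_fun M h s = emeasure M {x \<in> space M. norm (h x) > s}"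

text \<open>The infimum is taken in the extended nonnegative reals, so it is \<open>\<infinity>\<close> if no \<open>s\<close> qualifies.\<close>

definition decr_rearrangement :: "'a measure \<Rightarrow> ('a \<Rightarrow> complex) \<Rightarrow> real \<Rightarrow> ennreal" where
  "decr_rearrangement M h t =
     Inf {ennreal s | s. 0 < s \<and> distribution_fun M h s \<le> ennreal t}"

definition maximal_rearrangement :: "'a measure \<Rightarrow> ('a \<Rightarrow> complex) \<Rightarrow> real \<Rightarrow> ennreal" where
  "maximal_rearrangement M h t =
     (1 / ennreal t) * (\<integral>\<^sup>+ s\<in>{0<..<t}. decr_rearrangement M h s \<partial>lborel)"

text \<open>Powers with a positive real exponent on the extended nonnegative reals.\<close>

definition ennreal_rpow :: "ennreal \<Rightarrow> real \<Rightarrow> ennreal" where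
  "ennreal_rpow x a = (if x = \<infinity> then \<infinity> else ennreal (enn2real x powr a))"

definition lorentz_exponents :: "ennreal \<Rightarrow> ennreal \<Rightarrow> bool" where
  "lorentz_exponents p q \<longleftrightarrow>
     (1 < p \<and> p < \<infinity> \<and> 1 \<le> q \<and> q < \<infinity>) \<or> (1 < p \<and> p \<le> \<infinity> \<and> q = \<infinity>)"

text \<open>The exponent \<open>1/p\<close> is formed in the extended nonnegative reals, so it is \<open>0\<close> for \<open>p = \<infinity>\<close>.\<close>

definition lorentz_norm :: "'a measure \<Rightarrow> ennreal \<Rightarrow> ennreal \<Rightarrow> ('a \<Rightarrow> complex) \<Rightarrow> ennreal" where
  "lorentz_norm M p q h =
     (if q = \<infinity>
      then (SUP t\<in>{0<..}. ennreal (t powr enn2real (1 / p)) * maximal_rearrangement M h t)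
      else ennreal_rpow
             ((q / p) *
              (\<integral>\<^sup>+ t\<in>{0<..}.
                 (ennreal_rpow
                    (ennreal (t powr enn2real (1 / p)) * maximal_rearrangement M h t)
                    (enn2real q) / ennreal t) \<partial>lborel))
             (1 / enn2real q))"

definition ae_class :: "'a measure \<Rightarrow> ('a \<Rightarrow> complex) \<Rightarrow> ('a \<Rightarrow> complex) set" where
  "ae_class M h = {g \<in> borel_measurable M. AE x in M. g x = h x}"

definition lorentz_space :: "'a measure \<Rightarrow> ennreal \<Rightarrow> ennreal \<Rightarrow> ('a \<Rightarrow> complex) set set" where
  "lorentz_space M p q =
     {ae_class M h | h. h \<in> borel_measurable M \<and> lorentz_norm M p q h < \<infinity>}"

text \<open>The norm is constant on each class, so the infimum is the value at any representative.\<close>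

definition lorentz_class_norm ::
  "'a measure \<Rightarrow> ennreal \<Rightarrow> ennreal \<Rightarrow> ('a \<Rightarrow> complex) set \<Rightarrow> ennreal" where
  "lorentz_class_norm M p q F = (INF h\<in>F. lorentz_norm M p q h)"

section \<open>Transformations and weighted composition operators\<close>

definition nonsingular :: "'a measure \<Rightarrow> ('a \<Rightarrow> 'a) \<Rightarrow> bool" where
  "nonsingular M T \<longleftrightarrow>
     (\<forall>A\<in>sets M. emeasure M A = 0 \<longrightarrow> emeasure M (T -` A \<inter> space M) = 0)"

text \<open>The operator \<open>f \<mapsto> (u \<circ> T) \<cdot> (f \<circ> T)\<close> on classes modulo equality almost everywhere. If \<open>T\<close> is
  measurable and non-singular, all representatives \<open>f\<close> of \<open>F\<close> contribute the same class to the
  union.\<close>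

definition weighted_comp ::
  "'a measure \<Rightarrow> ('a \<Rightarrow> complex) \<Rightarrow> ('a \<Rightarrow> 'a) \<Rightarrow> ('a \<Rightarrow> complex) set \<Rightarrow> ('a \<Rightarrow> complex) set" where
  "weighted_comp M u T F = (\<Union>f\<in>F. ae_class M (\<lambda>x. u (T x) * f (T x)))"

text \<open>Linearity is not demanded here: it is automatic for weighted composition operators.\<close>

definition lorentz_bounded ::
  "'a measure \<Rightarrow> ennreal \<Rightarrow> ennreal \<Rightarrow> (('a \<Rightarrow> complex) set \<Rightarrow> ('a \<Rightarrow> complex) set) \<Rightarrow> bool" where
  "lorentz_bounded M p q L \<longleftrightarrow>
     (\<forall>F\<in>lorentz_space M p q. L F \<in> lorentz_space M p q) \<and>
     (\<exists>C::real. \<forall>F\<in>lorentz_space M p q.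
        lorentz_class_norm M p q (L F) \<le> ennreal C * lorentz_class_norm M p q F)"

text \<open>Descent of a self-map \<open>L\<close> of \<open>V\<close>; the infimum of the empty set in \<open>enat\<close> is \<open>\<infinity>\<close>.\<close>

definition descent :: "'v set \<Rightarrow> ('v \<Rightarrow> 'v) \<Rightarrow> enat" where
  "descent V L = Inf {enat k | k. (L ^^ (k + 1)) ` V = (L ^^ k) ` V}"

definition inj_ae_on :: "'a measure \<Rightarrow> ('a \<Rightarrow> 'a) \<Rightarrow> 'a set \<Rightarrow> bool" where
  "inj_ae_on M T S \<longleftrightarrow> {x \<in> S. \<exists>y\<in>S. y \<noteq> x \<and> T x = T y} \<in> null_sets M"

end

theory Submission
  imports Defs
begin

text \<open>If \<open>T\<close> is injective almost everywhere on \<open>S = T\<^sup>k(X)\<close>, then after discarding a null set it has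
  a measurable inverse on \<open>T(S)\<close>, because \<open>T\<close> maps measurable sets to measurable sets. For a given
  \<open>f\<close> the function \<open>g = (f \<circ> T\<^sup>-\<^sup>1) / u\<close> on \<open>T(S)\<close>, extended by zero, solves \<open>W\<^sup>k\<^sup>+\<^sup>1 g = W\<^sup>k f\<close>. Since
  \<open>T\<close> does not increase measure and \<open>\<bar>u\<bar> > \<epsilon>\<close>, we have \<open>\<mu>\<^sub>g(s) \<le> \<mu>\<^sub>f(\<epsilon> s)\<close>, so \<open>g\<close> lies in the Lorentz
  space. Hence the ranges stabilise at \<open>k\<close> and the descent is at most \<open>k\<close>.\<close>

section \<open>Domination in Lorentz spaces\<close>

text \<open>The integral of an arbitrary \<open>f\<close> is a supremum over simple functions, and
  dividing a simple function below \<open>c * f\<close> by \<open>c\<close> gives one below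
  \<open>f\<close>. Rearrangements can thus be scaled under the integral without any proof of their
  measurability.\<close>

lemma nn_integral_cmult_real_le:
  fixes c :: real
  assumes "0 < c"
  shows "(\<integral>\<^sup>+ x. ennreal c * f x \<partial>M) \<le> ennreal c * (\<integral>\<^sup>+ x. f x \<partial>M)"
proof -
  have inv: "ennreal (1 / c) * ennreal c = 1" "ennreal c * ennreal (1 / c) = 1"
    using assms by (simp_all flip: ennreal_mult)
  have "integral\<^sup>S M s \<le> ennreal c * (\<integral>\<^sup>+ x. f x \<partial>M)"
    if s: "simple_function M s" "s \<le> (\<lambda>x. ennreal c * f x)" for s
  proof -
    have "(\<integral>\<^sup>+ x. ennreal (1 / c) * s x \<partial>M) \<le> (\<integral>\<^sup>+ x. f x \<partial>M)"
    proof (rule nn_integral_mono)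
      fix x
      have "ennreal (1 / c) * s x \<le> ennreal (1 / c) * (ennreal c * f x)"
        using s(2) by (intro mult_left_mono) (auto simp: le_fun_def)
      then show "ennreal (1 / c) * s x \<le> f x"
        by (simp add: mult.assoc[symmetric] inv)
    qed
    also have "(\<integral>\<^sup>+ x. ennreal (1 / c) * s x \<partial>M) = ennreal (1 / c) * (\<integral>\<^sup>+ x. s x \<partial>M)"
      using s(1) by (intro nn_integral_cmult) (rule borel_measurable_simple_function)
    finally have "ennreal c * (ennreal (1 / c) * (\<integral>\<^sup>+ x. s x \<partial>M)) \<le> ennreal c * (\<integral>\<^sup>+ x. f x \<partial>M)"
      by (intro mult_left_mono) auto
    then show ?thesis
      using s(1) by (simp add: mult.assoc[symmetric] inv nn_integral_eq_simple_integral)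
  qed
  then show ?thesis
    unfolding nn_integral_def[of M "\<lambda>x. ennreal c * f x"] by (intro SUP_least) auto
qed

lemma ennreal_rpow_mono:
  assumes "0 \<le> a" "x \<le> y"
  shows "ennreal_rpow x a \<le> ennreal_rpow y a"
  using assms
  by (auto simp: ennreal_rpow_def top_unique less_top[symmetric]
      intro!: ennreal_leI powr_mono2 enn2real_mono)

lemma ennreal_rpow_cmult:
  assumes "0 < c"
  shows "ennreal_rpow (ennreal c * x) a = ennreal (c powr a) * ennreal_rpow x a"
  using assms
  by (auto simp: ennreal_rpow_def ennreal_mult_eq_top_iff ennreal_mult_top enn2real_mult powr_mult
      ennreal_mult)

lemma ennreal_rpow_less_top_iff: "ennreal_rpow x a < \<infinity> \<longleftrightarrow> x < \<infinity>"
  by (auto simp: ennreal_rpow_def less_top)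

text \<open>If \<open>s\<close> is admissible in the infimum for \<open>f\<close> at
  \<open>t\<close>, then \<open>c * s\<close> is admissible for \<open>g\<close>. The factor
  \<open>1 / c\<close> is kept on the left so that the bound can be checked for each
  \<open>s\<close> separately.\<close>

lemma decr_rearrangement_le_cmult:
  fixes c :: real
  assumes c: "0 < c"
    and dist: "\<And>s. 0 < s \<Longrightarrow> distribution_fun M g (c * s) \<le> distribution_fun M f s"
  shows "decr_rearrangement M g t \<le> ennreal c * decr_rearrangement M f t"
proof -
  have inv: "ennreal (1 / c) * ennreal c = 1" "ennreal c * ennreal (1 / c) = 1"
    using c by (simp_all flip: ennreal_mult)
  have "ennreal (1 / c) * decr_rearrangement M g t \<le> decr_rearrangement M f t"
    unfolding decr_rearrangement_def[of M f]
  proof (rule Inf_greatest, clarify)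
    fix s :: real
    assume s: "0 < s" "distribution_fun M f s \<le> ennreal t"
    have "decr_rearrangement M g t \<le> ennreal (c * s)"
      unfolding decr_rearrangement_def using s c dist[OF s(1)]
      by (intro Inf_lower) (auto intro!: exI[of _ "c * s"])
    then have "ennreal (1 / c) * decr_rearrangement M g t \<le> ennreal (1 / c) * ennreal (c * s)"
      by (intro mult_left_mono) auto
    then show "ennreal (1 / c) * decr_rearrangement M g t \<le> ennreal s"
      using s c by (simp flip: ennreal_mult)
  qed
  then have "ennreal c * (ennreal (1 / c) * decr_rearrangement M g t)
      \<le> ennreal c * decr_rearrangement M f t"
    by (intro mult_left_mono) auto
  then show ?thesis
    by (simp add: mult.assoc[symmetric] inv)
qed

lemma maximal_rearrangement_le_cmult:
  fixes c :: real
  assumes c: "0 < c"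
    and dist: "\<And>s. 0 < s \<Longrightarrow> distribution_fun M g (c * s) \<le> distribution_fun M f s"
  shows "maximal_rearrangement M g t \<le> ennreal c * maximal_rearrangement M f t"
proof -
  have "(\<integral>\<^sup>+ s\<in>{0<..<t}. decr_rearrangement M g s \<partial>lborel)
      \<le> (\<integral>\<^sup>+ s. ennreal c * (decr_rearrangement M f s * indicator {0<..<t} s) \<partial>lborel)"
    using decr_rearrangement_le_cmult[OF assms]
    by (intro nn_integral_mono) (auto simp: indicator_def)
  also have "\<dots> \<le> ennreal c * (\<integral>\<^sup>+ s\<in>{0<..<t}. decr_rearrangement M f s \<partial>lborel)"
    using c by (rule nn_integral_cmult_real_le)
  finally show ?thesis
    unfolding maximal_rearrangement_def
    by (subst mult.left_commute) (intro mult_left_mono, auto)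
qed

text \<open>The constant \<open>c\<close> passes from the rearrangement to its average and then
  through the supremum or the weighted integral. Only finiteness is recorded, which is what
  membership in the space asks for.\<close>

lemma lorentz_norm_finite_dominated:
  fixes c :: real
  assumes c: "0 < c"
    and dist: "\<And>s. 0 < s \<Longrightarrow> distribution_fun M g (c * s) \<le> distribution_fun M f s"
    and fin: "lorentz_norm M p q f < \<infinity>"
  shows "lorentz_norm M p q g < \<infinity>"
proof -
  define w where "w h t = ennreal (t powr enn2real (1 / p)) * maximal_rearrangement M h t" for h t
  have w_le: "w g t \<le> ennreal c * w f t" for t
    unfolding w_def using maximal_rearrangement_le_cmult[OF c dist]
    by (subst mult.left_commute) (intro mult_left_mono, auto)
  show ?thesis
  proof (cases "q = \<infinity>")
    case True
    have "(SUP t\<in>{0<..}. w g t) \<le> ennreal c * (SUP t\<in>{0<..}. w f t)"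
      by (intro SUP_least order_trans[OF w_le] mult_left_mono SUP_upper) auto
    also have "\<dots> < \<infinity>"
      using fin True by (auto simp: lorentz_norm_def w_def ennreal_mult_less_top)
    finally show ?thesis
      using True by (simp add: lorentz_norm_def w_def)
  next
    case False
    define J where
      "J h = (\<integral>\<^sup>+ t\<in>{0<..}. (ennreal_rpow (w h t) (enn2real q) / ennreal t) \<partial>lborel)" for h
    have norm_eq: "lorentz_norm M p q h = ennreal_rpow ((q / p) * J h) (1 / enn2real q)" for h
      using False by (simp add: lorentz_norm_def w_def J_def)
    \<comment> \<open>The integrand carries the power \<open>q\<close>, so \<open>c\<close> leaves
      the integral as \<open>c powr q\<close>.\<close>
    define c' where "c' = c powr enn2real q"
    have c': "0 < c'"
      using c by (simp add: c'_def)
    have rpow_le: "ennreal_rpow (w g t) (enn2real q) \<le> ennreal c' * ennreal_rpow (w f t) (enn2real q)" for t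
      unfolding c'_def ennreal_rpow_cmult[OF c, symmetric]
      by (intro ennreal_rpow_mono w_le) simp
    have "J g \<le> (\<integral>\<^sup>+ t. ennreal c' *
        ((ennreal_rpow (w f t) (enn2real q) / ennreal t) * indicator {0<..} t) \<partial>lborel)"
      unfolding J_def
      by (intro nn_integral_mono)
        (auto simp: indicator_def ennreal_times_divide intro!: divide_right_mono_ennreal rpow_le)
    also have "\<dots> \<le> ennreal c' * J f"
      unfolding J_def using c' by (rule nn_integral_cmult_real_le)
    finally have "(q / p) * J g \<le> ennreal c' * ((q / p) * J f)"
      by (subst mult.left_commute) (intro mult_left_mono, auto)
    also have "\<dots> < \<infinity>"
    proof -
      have "(q / p) * J f < \<infinity>"
        using fin unfolding norm_eq ennreal_rpow_less_top_iff .
      then show ?thesis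
        by (simp add: ennreal_mult_less_top)
    qed
    finally show ?thesis
      unfolding norm_eq ennreal_rpow_less_top_iff .
  qed
qed

section \<open>Powers of weighted composition operators\<close>

lemma ae_class_cong:
  assumes "AE x in M. f x = g x"
  shows "ae_class M f = ae_class M g"
  unfolding ae_class_def
proof (intro Collect_cong conj_cong refl)
  fix h
  show "(AE x in M. h x = f x) \<longleftrightarrow> (AE x in M. h x = g x)"
    using assms by (intro eventually_subst) (auto elim: eventually_mono)
qed

lemma nonsingular_AE:
  assumes T: "T \<in> measurable M M" and ns: "nonsingular M T" and P: "AE x in M. P x"
  shows "AE x in M. P (T x)"
proof -
  obtain N where N: "{x \<in> space M. \<not> P x} \<subseteq> N" "emeasure M N = 0" "N \<in> sets M"
    using P by (rule AE_E)
  show ?thesis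
  proof (rule AE_I)
    show "{x \<in> space M. \<not> P (T x)} \<subseteq> T -` N \<inter> space M"
      using N(1) measurable_space[OF T] by auto
    show "emeasure M (T -` N \<inter> space M) = 0"
      using ns N unfolding nonsingular_def by blast
    show "T -` N \<inter> space M \<in> sets M"
      using T N(3) by (rule measurable_sets)
  qed
qed

lemma nonsingular_AE_funpow:
  assumes "T \<in> measurable M M" and "nonsingular M T" and "AE x in M. P x"
  shows "AE x in M. P ((T ^^ k) x)"
proof (induction k)
  case (Suc k)
  then show ?case
    using nonsingular_AE[OF assms(1,2) Suc] by (simp add: funpow_swap1)
qed (use assms in simp)

text \<open>By non-singularity, representatives that agree a.e. still agree a.e. after composition
  with \<open>T\<close>, so the union collapses to one class.\<close>

lemma weighted_comp_ae_class:
  assumes T: "T \<in> measurable M M" and ns: "nonsingular M T"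
    and f: "f \<in> borel_measurable M"
  shows "weighted_comp M u T (ae_class M f) = ae_class M (\<lambda>x. u (T x) * f (T x))"
proof -
  have "ae_class M (\<lambda>x. u (T x) * h (T x)) = ae_class M (\<lambda>x. u (T x) * f (T x))"
    if "h \<in> ae_class M f" for h
  proof (rule ae_class_cong)
    have "AE x in M. h x = f x"
      using that by (simp add: ae_class_def)
    from nonsingular_AE[OF T ns this]
    show "AE x in M. u (T x) * h (T x) = u (T x) * f (T x)"
      by (rule AE_mp) (auto intro: AE_I2)
  qed
  moreover have "f \<in> ae_class M f"
    using f by (simp add: ae_class_def)
  ultimately show ?thesis
    unfolding weighted_comp_def by blast
qed

lemma measurable_funpow:
  assumes "T \<in> measurable M M"
  shows "T ^^ k \<in> measurable M M"
  using assms by (induction k) (auto intro: measurable_comp)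

text \<open>The exponents run over 1,...,k because the weight is evaluated at \<open>T x\<close>.
  The formula shows that the result depends on \<open>f\<close> only through its values at the
  points \<open>(T ^^ k) x\<close>.\<close>

lemma weighted_comp_funpow_ae_class:
  assumes T: "T \<in> measurable M M" and ns: "nonsingular M T"
    and u: "u \<in> borel_measurable M" and f: "f \<in> borel_measurable M"
  shows "(weighted_comp M u T ^^ k) (ae_class M f) =
    ae_class M (\<lambda>x. (\<Prod>i<k. u ((T ^^ Suc i) x)) * f ((T ^^ k) x))"
proof (induction k)
  case (Suc k)
  have meas: "(\<lambda>x. (\<Prod>i<k. u ((T ^^ Suc i) x)) * f ((T ^^ k) x)) \<in> borel_measurable M"
    by (intro borel_measurable_times borel_measurable_prod
        measurable_compose[OF measurable_funpow[OF T] u] measurable_compose[OF measurable_funpow[OF T] f])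
  show ?case
    unfolding funpow.simps(2)[of k "weighted_comp M u T"] comp_apply Suc
      weighted_comp_ae_class[OF T ns meas]
    by (simp add: prod.lessThan_Suc_shift mult.assoc funpow_swap1 del: prod.lessThan_Suc)
qed simp

section \<open>Measurable images, and inversion where \<open>T\<close> is injective\<close>

lemma funpow_image_sets:
  assumes "\<And>A. A \<in> sets M \<Longrightarrow> T ` A \<in> sets M"
  shows "(T ^^ k) ` space M \<in> sets M"
proof (induction k)
  case (Suc k)
  then show ?case
    using assms[OF Suc] by (simp add: image_comp)
qed simp

lemma borel_measurable_the_inv_into:
  fixes f :: "'a \<Rightarrow> 'b::{topological_space, zero}"
  assumes img: "\<And>A. A \<in> sets M \<Longrightarrow> T ` A \<in> sets M"
    and D: "D \<in> sets M" and inj: "inj_on T D" and f: "f \<in> borel_measurable M"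
  shows "(\<lambda>y. if y \<in> T ` D then f (the_inv_into D T y) else 0) \<in> borel_measurable M"
proof (rule measurableI)
  fix B :: "'b set"
  assume B: "B \<in> sets borel"
  have DM: "D \<subseteq> space M" and TD: "T ` D \<subseteq> space M"
    using D img[OF D] by (auto dest: sets.sets_into_space)
  have "(\<lambda>y. if y \<in> T ` D then f (the_inv_into D T y) else 0) -` B \<inter> space M =
      T ` (D \<inter> (f -` B \<inter> space M)) \<union> (if 0 \<in> B then space M - T ` D else {})" (is "?L = ?R")
  proof (rule set_eqI)
    fix y
    show "y \<in> ?L \<longleftrightarrow> y \<in> ?R"
    proof (cases "y \<in> T ` D")
      case True
      then obtain z where z: "z \<in> D" "y = T z"
        by blast
      have "z' = z" if "z' \<in> D" "T z' = T z" for z'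
        using inj_onD[OF inj that(2,1) z(1)] .
      then have "y \<in> ?R \<longleftrightarrow> f z \<in> B"
        using z DM by force
      moreover have "y \<in> ?L \<longleftrightarrow> f z \<in> B"
        using z TD inj by (auto simp: the_inv_into_f_f)
      ultimately show ?thesis
        by blast
    qed auto
  qed
  also have "\<dots> \<in> sets M"
    using D img[OF D] img[of "D \<inter> (f -` B \<inter> space M)"] measurable_sets[OF f B] by auto
  finally show "(\<lambda>y. if y \<in> T ` D then f (the_inv_into D T y) else 0) -` B \<inter> space M \<in> sets M" .
qed simp

lemma weighted_comp_solve:
  assumes img: "\<And>A. A \<in> sets M \<Longrightarrow> T ` A \<in> sets M \<and> emeasure M (T ` A) \<le> emeasure M A"
    and u: "u \<in> borel_measurable M"
    and \<epsilon>: "0 < \<epsilon>" "AE x in M. norm (u x) > \<epsilon>"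
    and D: "D \<in> sets M" and inj: "inj_on T D"
    and f: "f \<in> borel_measurable M" "lorentz_norm M p q f < \<infinity>"
  obtains g where "g \<in> borel_measurable M" "lorentz_norm M p q g < \<infinity>"
    "\<And>z. z \<in> D \<Longrightarrow> u (T z) \<noteq> 0 \<Longrightarrow> u (T z) * g (T z) = f z"
proof
  \<comment> \<open>The weight is divided out at \<open>y = T z\<close>, where the operator
    evaluates it. Division by zero yields 0, which keeps \<open>g\<close> total.\<close>
  define g where "g y = (if y \<in> T ` D then f (the_inv_into D T y) else 0) / u y" for y
  show g: "g \<in> borel_measurable M"
    unfolding g_def using img D inj f(1) u
    by (intro borel_measurable_divide borel_measurable_the_inv_into) auto
  show "u (T z) * g (T z) = f z" if "z \<in> D" "u (T z) \<noteq> 0" for z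
    using that inj by (simp add: g_def the_inv_into_f_f)
  have dist: "distribution_fun M g (1 / \<epsilon> * s) \<le> distribution_fun M f s" if s: "0 < s" for s
  proof -
    let ?A = "{z \<in> space M. norm (f z) > s}"
    have A: "?A \<in> sets M"
      using f(1) by measurable
    have DM: "D \<subseteq> space M"
      using D by (rule sets.sets_into_space)
    have "distribution_fun M g (1 / \<epsilon> * s) \<le> emeasure M (T ` (D \<inter> ?A))"
      unfolding distribution_fun_def
    proof (rule emeasure_mono_AE)
      show "AE x in M. x \<in> {x \<in> space M. 1 / \<epsilon> * s < norm (g x)} \<longrightarrow> x \<in> T ` (D \<inter> ?A)"
        using \<epsilon>(2)
      proof (rule AE_mp, intro AE_I2 impI)
        fix x
        assume ux: "\<epsilon> < norm (u x)" and x: "x \<in> {x \<in> space M. 1 / \<epsilon> * s < norm (g x)}"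
        have "0 < s / \<epsilon>"
          using s \<epsilon>(1) by simp
        with x have "g x \<noteq> 0"
          by auto
        then obtain z where z: "z \<in> D" "x = T z"
          by (auto simp: g_def split: if_splits)
        have "s / \<epsilon> < norm (f z) / norm (u x)"
          using x z inj by (auto simp: g_def the_inv_into_f_f norm_divide)
        also have "\<dots> \<le> norm (f z) / \<epsilon>"
          using ux \<epsilon>(1) by (intro divide_left_mono mult_pos_pos) auto
        finally have "s < norm (f z)"
          using \<epsilon>(1) by (simp add: divide_less_cancel)
        then show "x \<in> T ` (D \<inter> ?A)"
          using z DM by auto
      qed
      show "T ` (D \<inter> ?A) \<in> sets M"
        using img A D by blast
    qed
    also have "\<dots> \<le> emeasure M (D \<inter> ?A)"
      using img A D by blast
    also have "\<dots> \<le> emeasure M ?A"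
      using A by (intro emeasure_mono) auto
    finally show ?thesis
      by (simp add: distribution_fun_def)
  qed
  show "lorentz_norm M p q g < \<infinity>"
    by (rule lorentz_norm_finite_dominated[OF _ dist f(2)]) (use \<epsilon>(1) in auto)
qed

section \<open>Stabilisation of the ranges\<close>

theorem theorem4p20:
  fixes M :: "'a measure" and T :: "'a \<Rightarrow> 'a" and u :: "'a \<Rightarrow> complex" and p q :: ennreal
  assumes "sigma_finite_measure M" and "complete_measure M"
    and "lorentz_exponents p q"
    and "T \<in> measurable M M" and "nonsingular M T"
    and "\<And>A. A \<in> sets M \<Longrightarrow> T ` A \<in> sets M \<and> emeasure M (T ` A) \<le> emeasure M A"
    and "u \<in> borel_measurable M"
    and "\<exists>\<epsilon>::real. \<epsilon> > 0 \<and> (AE x in M. norm (u x) > \<epsilon>)"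
    and "lorentz_bounded M p q (weighted_comp M u T)"
    and "descent (lorentz_space M p q) (weighted_comp M u T) = \<infinity>"
  shows "\<forall>k::nat. \<not> inj_ae_on M T ((T ^^ k) ` space M)"
proof (rule allI, rule notI)
  fix k
  assume "inj_ae_on M T ((T ^^ k) ` space M)"
  let ?V = "lorentz_space M p q" and ?W = "weighted_comp M u T"
  define S where "S = (T ^^ k) ` space M"
  define N where "N = {x \<in> S. \<exists>y\<in>S. y \<noteq> x \<and> T x = T y}"
  note T = assms(4) and ns = assms(5) and img = assms(6) and u = assms(7)
  obtain \<epsilon> :: real where \<epsilon>: "0 < \<epsilon>" "AE x in M. norm (u x) > \<epsilon>"
    using assms(8) by blast
  have N: "N \<in> null_sets M"
    using \<open>inj_ae_on M T ((T ^^ k) ` space M)\<close> by (simp add: inj_ae_on_def N_def S_def)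
  have S: "S \<in> sets M"
    unfolding S_def using img by (intro funpow_image_sets) auto
  have D: "S - N \<in> sets M"
    using S N by auto
  \<comment> \<open>\<open>N\<close> contains both points of every colliding pair in
    \<open>S\<close>, so no collision survives its removal.\<close>
  have inj: "inj_on T (S - N)"
    by (auto simp: inj_on_def N_def)
  \<comment> \<open>The k-th iterate always lands in \<open>S\<close>. Non-singularity pulls the
    null set \<open>N\<close>, and the null set where the bound on \<open>u\<close> fails, back to
    null sets under iterates of \<open>T\<close>.\<close>
  have good: "AE x in M. (T ^^ k) x \<in> S - N \<and> u (T ((T ^^ k) x)) \<noteq> 0"
  proof -
    have 1: "AE x in M. (T ^^ k) x \<notin> N"
      using nonsingular_AE_funpow[OF T ns AE_not_in[OF N]] .
    have 2: "AE x in M. norm (u ((T ^^ Suc k) x)) > \<epsilon>"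
      using nonsingular_AE_funpow[OF T ns \<epsilon>(2)] .
    show ?thesis
      using 1 2 AE_space by eventually_elim (use \<epsilon>(1) in \<open>auto simp: S_def\<close>)
  qed
  have "(?W ^^ (k + 1)) ` ?V = (?W ^^ k) ` ?V"
  proof
    have "?W F \<in> ?V" if "F \<in> ?V" for F
      using assms(9) that by (simp add: lorentz_bounded_def)
    \<comment> \<open>Applying the innermost \<open>?W\<close> first stays inside \<open>?V\<close>,
      so the remaining k applications give an element of the right-hand side.\<close>
    then show "(?W ^^ (k + 1)) ` ?V \<subseteq> (?W ^^ k) ` ?V"
      by (auto simp: funpow_Suc_right simp del: funpow.simps)
    show "(?W ^^ k) ` ?V \<subseteq> (?W ^^ (k + 1)) ` ?V"
    proof (clarify)
      fix F
      assume "F \<in> ?V"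
      then obtain f where f: "F = ae_class M f" "f \<in> borel_measurable M" "lorentz_norm M p q f < \<infinity>"
        by (auto simp: lorentz_space_def)
      obtain g where g: "g \<in> borel_measurable M" "lorentz_norm M p q g < \<infinity>"
        and solve: "\<And>z. z \<in> S - N \<Longrightarrow> u (T z) \<noteq> 0 \<Longrightarrow> u (T z) * g (T z) = f z"
        using weighted_comp_solve[OF img u \<epsilon> D inj f(2,3)] by blast
      have h: "(\<lambda>z. u (T z) * g (T z)) \<in> borel_measurable M"
        using measurable_compose[OF T u] measurable_compose[OF T g(1)] by simp
      \<comment> \<open>Peeling off the innermost \<open>?W\<close> leaves the same power k on both
        sides. The function \<open>u (T z) * g (T z)\<close> then has to match \<open>f z\<close>
        only at \<open>z = (T ^^ k) x\<close> for almost every \<open>x\<close>, which is what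
        \<open>good\<close> and \<open>solve\<close> provide.\<close>
      have "(?W ^^ (k + 1)) (ae_class M g) = (?W ^^ k) (ae_class M (\<lambda>z. u (T z) * g (T z)))"
        by (simp add: funpow_Suc_right weighted_comp_ae_class[OF T ns g(1)] del: funpow.simps)
      also have "\<dots> = (?W ^^ k) F"
        unfolding f(1) weighted_comp_funpow_ae_class[OF T ns u h]
          weighted_comp_funpow_ae_class[OF T ns u f(2)]
        by (rule ae_class_cong, rule AE_mp[OF good]) (auto intro!: AE_I2 simp: solve)
      finally have "(?W ^^ k) F = (?W ^^ (k + 1)) (ae_class M g)" ..
      moreover have "ae_class M g \<in> ?V"
        using g by (auto simp: lorentz_space_def)
      ultimately show "(?W ^^ k) F \<in> (?W ^^ (k + 1)) ` ?V"
        by blast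
    qed
  qed
  \<comment> \<open>Equality of the two ranges puts k into the set whose infimum is the descent,
    against its being infinite.\<close>
  then have "descent ?V ?W \<le> enat k"
    unfolding descent_def by (intro Inf_lower) blast
  then show False
    using assms(10) by simp
qed

end
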